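(* Let $S$ be a semiring. Then (i) $\mathrm{rad}_m(S)=\bigcap_{\mu\in\mathcal{RC}_m(S)}\mu$; (ii) $\mathrm{rad}_s(S)=\bigcap_{\mu\in\mathcal{RC}_s(S)}\mu$.
   Context: A semiring $(S,+,\cdot)$ is a set with $(S,+)$ a commutative monoid with identity $0$, $(S,\cdot)$ a semigroup (no multiplicative identity is assumed), multiplication distributing over addition on both sides, and $0s=s0=0$ for all $s$. $\nabla_S=S\times S$. An $S$-semimodule is a right $S$-semimodule: a commutative monoid $(M,+,0_M)$ with a map $M\times S\to M$ such that $(m_1+m_2)s=m_1s+m_2s$, $m(s_1+s_2)=ms_1+ms_2$, $m(s_1s_2)=(ms_1)s_2$, $m0=0_M=0_Ms$. $M$ is called minimal if $MS\neq 0$ (i.e. $ms\ne 0_M$ for some $m\in M,s\in S$) and its only subsemimodules are $(0)$ and $M$; it is called simple if it is minimal and its only $S$-semimodule congruences are the equality relation and $M\times M$. $\mathrm{ann}_S(M)=\{(s_1,s_2)\in S\times S\mid ms_1=ms_2 \text{ for all } m\in M\}$. $\mathrm{rad}_m(S)$ (resp. $\mathrm{rad}_s(S)$) is the intersection of $\mathrm{ann}_S(M)$ over all minimal (resp. simple) $S$-semimodules $M$, and is $\nabla_S$ if there are none. A right congruence on $S$ is an equivalence relation $\mu$ such that $(a,b)\in\mu$ implies $(a+c,b+c),(ac,bc)\in\mu$ for all $c\in S$; $[s]_\mu$ denotes the $\mu$-class of $s$. $\mu$ is regular if there exists $e\in S$ with $(es,s)\in\mu$ for every $s\in S$. A right ideal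 $I$ of $S$ is $\mu$-saturated if for all $s\in S$, $i\in I$, $(s,i)\in\mu$ implies $s\in I$; a maximal $\mu$-saturated right ideal is one maximal under inclusion among the proper $\mu$-saturated right ideals. $\mathcal{RC}_m(S)$ is the set of m-regular right congruences: regular right congruences $\mu$ such that $[0]_\mu$ is a maximal $\mu$-saturated right ideal. $\mathcal{RC}_s(S)$ is the set of s-regular right congruences: maximal regular right congruences $\mu$ (i.e. maximal under inclusion among regular right congruences different from $\nabla_S$) such that $[0]_\mu$ is a maximal $\mu$-saturated right ideal. An intersection over an empty set of right congruences is $\nabla_S$. *)

theory Defs
  imports "HOL-Algebra.Group"
begin

text \<open>
  The class \<^class>\<open>semiring_0\<close> is exactly the notion of semiring used here: an additive commutative
  monoid, a multiplicative semigroup (with no identity), both distributive laws, and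
  an absorbing zero. Semimodules, over which the radicals range, are carrier-based.
\<close>

locale right_semimodule =
  fixes M :: "'u set"
    and add :: "'u \<Rightarrow> 'u \<Rightarrow> 'u"
    and zero :: 'u
    and act :: "'u \<Rightarrow> 'a::semiring_0 \<Rightarrow> 'u"
  assumes comm_monoid: "comm_monoid \<lparr>carrier = M, monoid.mult = add, one = zero\<rparr>"
    and act_closed: "m \<in> M \<Longrightarrow> act m s \<in> M"
    and act_add_left: "m \<in> M \<Longrightarrow> m' \<in> M \<Longrightarrow> act (add m m') s = add (act m s) (act m' s)"
    and act_add_right: "m \<in> M \<Longrightarrow> act m (s + t) = add (act m s) (act m t)"
    and act_mult: "m \<in> M \<Longrightarrow> act m (s * t) = act (act m s) t"
    and act_zero_right: "m \<in> M \<Longrightarrow> act m 0 = zero"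
    and act_zero_left: "act zero s = zero"

definition subsemimodule ::
  "'u set \<Rightarrow> ('u \<Rightarrow> 'u \<Rightarrow> 'u) \<Rightarrow> 'u \<Rightarrow> ('u \<Rightarrow> 'a::semiring_0 \<Rightarrow> 'u) \<Rightarrow> 'u set \<Rightarrow> bool" where
  "subsemimodule M add zero act N \<longleftrightarrow>
     N \<subseteq> M \<and> zero \<in> N \<and> (\<forall>x\<in>N. \<forall>y\<in>N. add x y \<in> N) \<and> (\<forall>x\<in>N. \<forall>s. act x s \<in> N)"

definition semimodule_congruence ::
  "'u set \<Rightarrow> ('u \<Rightarrow> 'u \<Rightarrow> 'u) \<Rightarrow> ('u \<Rightarrow> 'a::semiring_0 \<Rightarrow> 'u) \<Rightarrow> ('u \<times> 'u) set \<Rightarrow> bool" where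
  "semimodule_congruence M add act \<rho> \<longleftrightarrow>
     equiv M \<rho> \<and>
     (\<forall>(x, y)\<in>\<rho>. (\<forall>z\<in>M. (add x z, add y z) \<in> \<rho>) \<and> (\<forall>s. (act x s, act y s) \<in> \<rho>))"

definition minimal_semimodule ::
  "'u set \<Rightarrow> ('u \<Rightarrow> 'u \<Rightarrow> 'u) \<Rightarrow> 'u \<Rightarrow> ('u \<Rightarrow> 'a::semiring_0 \<Rightarrow> 'u) \<Rightarrow> bool" where
  "minimal_semimodule M add zero act \<longleftrightarrow>
     right_semimodule M add zero act \<and>
     (\<exists>m\<in>M. \<exists>s. act m s \<noteq> zero) \<and>
     (\<forall>N. subsemimodule M add zero act N \<longrightarrow> N = {zero} \<or> N = M)"

definition simple_semimodule ::
  "'u set \<Rightarrow> ('u \<Rightarrow> 'u \<Rightarrow> 'u) \<Rightarrow> 'u \<Rightarrow> ('u \<Rightarrow> 'a::semiring_0 \<Rightarrow> 'u) \<Rightarrow> bool" where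
  "simple_semimodule M add zero act \<longleftrightarrow>
     minimal_semimodule M add zero act \<and>
     (\<forall>\<rho>. semimodule_congruence M add act \<rho> \<longrightarrow> \<rho> = Id_on M \<or> \<rho> = M \<times> M)"

definition ann :: "'u set \<Rightarrow> ('u \<Rightarrow> 'a::semiring_0 \<Rightarrow> 'u) \<Rightarrow> ('a \<times> 'a) set" where
  "ann M act = {(s, t). \<forall>m\<in>M. act m s = act m t}"

text \<open>
  HOL cannot quantify over all types inside a definition, so the radicals take as a parameter the
  type whose subsets serve as carriers of semimodules. This
  type has to be large enough to play the role of the class of all semimodules: on a one-element
  type, for example, there is no minimal semimodule at all. Since \<open>\<Inter>{} = UNIV\<close>, a radical is the full
  relation when there are no semimodules of the kind considered.
\<close>

definition rad_m :: "'u itself \<Rightarrow> ('a::semiring_0 \<times> 'a) set" where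
  "rad_m (_ :: 'u itself) =
     \<Inter> {ann M act | (M :: 'u set) add zero act. minimal_semimodule M add zero act}"

definition rad_s :: "'u itself \<Rightarrow> ('a::semiring_0 \<times> 'a) set" where
  "rad_s (_ :: 'u itself) =
     \<Inter> {ann M act | (M :: 'u set) add zero act. simple_semimodule M add zero act}"

definition right_congruence :: "('a::semiring_0 \<times> 'a) set \<Rightarrow> bool" where
  "right_congruence \<mu> \<longleftrightarrow>
     equiv UNIV \<mu> \<and> (\<forall>(a, b)\<in>\<mu>. \<forall>c. (a + c, b + c) \<in> \<mu> \<and> (a * c, b * c) \<in> \<mu>)"

definition regular_right_congruence :: "('a::semiring_0 \<times> 'a) set \<Rightarrow> bool" where
  "regular_right_congruence \<mu> \<longleftrightarrow> right_congruence \<mu> \<and> (\<exists>e. \<forall>s. (e * s, s) \<in> \<mu>)"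

definition maximal_regular_right_congruence :: "('a::semiring_0 \<times> 'a) set \<Rightarrow> bool" where
  "maximal_regular_right_congruence \<mu> \<longleftrightarrow>
     regular_right_congruence \<mu> \<and> \<mu> \<noteq> UNIV \<and>
     (\<forall>\<nu>. regular_right_congruence \<nu> \<and> \<nu> \<noteq> UNIV \<and> \<mu> \<subseteq> \<nu> \<longrightarrow> \<nu> = \<mu>)"

definition right_ideal :: "'a::semiring_0 set \<Rightarrow> bool" where
  "right_ideal I \<longleftrightarrow>
     0 \<in> I \<and> (\<forall>x\<in>I. \<forall>y\<in>I. x + y \<in> I) \<and> (\<forall>x\<in>I. \<forall>s. x * s \<in> I)"

definition saturated_right_ideal :: "('a::semiring_0 \<times> 'a) set \<Rightarrow> 'a set \<Rightarrow> bool" where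
  "saturated_right_ideal \<mu> I \<longleftrightarrow> right_ideal I \<and> (\<forall>s. \<forall>i\<in>I. (s, i) \<in> \<mu> \<longrightarrow> s \<in> I)"

definition maximal_saturated_right_ideal :: "('a::semiring_0 \<times> 'a) set \<Rightarrow> 'a set \<Rightarrow> bool" where
  "maximal_saturated_right_ideal \<mu> I \<longleftrightarrow>
     saturated_right_ideal \<mu> I \<and> I \<noteq> UNIV \<and>
     (\<forall>J. saturated_right_ideal \<mu> J \<and> J \<noteq> UNIV \<and> I \<subseteq> J \<longrightarrow> J = I)"

definition RC_m :: "('a::semiring_0 \<times> 'a) set set" where
  "RC_m = {\<mu>. regular_right_congruence \<mu> \<and> maximal_saturated_right_ideal \<mu> (\<mu> `` {0})}"

definition RC_s :: "('a::semiring_0 \<times> 'a) set set" where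
  "RC_s = {\<mu>. maximal_regular_right_congruence \<mu> \<and> maximal_saturated_right_ideal \<mu> (\<mu> `` {0})}"

end

theory Submission
  imports Defs
begin

text \<open>
  Both radicals are computed by describing minimal and simple semimodules as quotients of the
  semiring \<open>S\<close> by right congruences. Let \<open>\<pi>: S \<rightarrow> M\<close> be a surjective homomorphism of right
  semimodules whose kernel congruence is regular. The lattice correspondence then matches
  the subsemimodules of \<open>M\<close> with the \<open>ker \<pi>\<close>-saturated right ideals of \<open>S\<close>, and the congruences
  of \<open>M\<close> with the right congruences of \<open>S\<close> above \<open>ker \<pi>\<close>. All of the latter are regular, because the
  element \<open>e\<close> witnessing regularity of a congruence also works for every larger one. Hence \<open>M\<close>
  is minimal (simple) exactly when \<open>ker \<pi>\<close> is m-regular (s-regular): \<open>minimal_iff_kernel\<close>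
  and \<open>simple_iff_kernel\<close>.

  Two sources of such presentations give the two inclusions. Every regular right congruence
  \<open>\<mu>\<close> is the kernel of the projection to \<open>S/\<mu>\<close>, and \<open>ann (S/\<mu>) \<subseteq> \<mu>\<close>, since elements that act in the
  same way on the class of \<open>e\<close> are congruent; so the radical is contained in every \<open>\<mu>\<close>. In the other
  direction, let \<open>m\<close> be an element of a minimal \<open>M\<close>. Either \<open>m\<close> is annihilated by all of \<open>S\<close>, and
  then it imposes no condition in \<open>ann M\<close>, or \<open>mS = M\<close>; in that case
  \<open>s \<mapsto> ms\<close> is a presentation, with \<open>e\<close> any solution of \<open>me = m\<close>. So \<open>ann M\<close> is
  an intersection of kernels of presentations of \<open>M\<close>.
\<close>

section \<open>Presentations of semimodules by regular right congruences\<close>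

lemma (in right_semimodule) zero_closed: "zero \<in> M"
  using monoid.one_closed[OF comm_monoid.axioms(1)[OF comm_monoid]] by simp

locale regular_presentation = right_semimodule M add zero act
  for M :: "'u set" and add zero and act :: "'u \<Rightarrow> 'a::semiring_0 \<Rightarrow> 'u" +
  fixes \<pi> :: "'a \<Rightarrow> 'u" and e :: 'a
  assumes range_eq: "range \<pi> = M"
    and hom_add: "\<pi> (x + y) = add (\<pi> x) (\<pi> y)"
    and hom_act: "\<pi> (x * s) = act (\<pi> x) s"
    and unit: "\<pi> (e * s) = \<pi> s"
begin

definition ker :: "('a \<times> 'a) set" where
  "ker = {(x, y). \<pi> x = \<pi> y}"

lemma mem_ker [simp]: "(x, y) \<in> ker \<longleftrightarrow> \<pi> x = \<pi> y"
  by (simp add: ker_def)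

lemma image_mem [simp]: "\<pi> x \<in> M"
  using range_eq by blast

lemma hom_zero: "\<pi> 0 = zero"
  using hom_act[of 0 0] act_zero_right[OF image_mem] by simp

lemma ker_zero_class: "ker `` {0} = \<pi> -` {zero}"
  by (auto simp: hom_zero)

lemma regular_ker: "regular_right_congruence ker"
proof -
  have "equiv UNIV ker"
    by (auto intro!: equivI refl_onI symI transI)
  then show ?thesis
    unfolding regular_right_congruence_def right_congruence_def
    using unit by (auto simp: hom_add hom_act)
qed

lemma regular_above_ker:
  assumes "right_congruence \<nu>" "ker \<subseteq> \<nu>"
  shows "regular_right_congruence \<nu>"
  unfolding regular_right_congruence_def using assms unit by (auto simp: subset_iff)

subsection \<open>Subsemimodules and saturated right ideals\<close>

lemma saturated_vimage:
  assumes "subsemimodule M add zero act N"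
  shows "saturated_right_ideal ker (\<pi> -` N)"
  using assms
  by (auto simp: subsemimodule_def saturated_right_ideal_def right_ideal_def hom_zero hom_add hom_act)

lemma subsemimodule_image:
  assumes "saturated_right_ideal ker J"
  shows "subsemimodule M add zero act (\<pi> ` J)"
  unfolding subsemimodule_def
proof (intro conjI ballI allI)
  show "\<pi> ` J \<subseteq> M" by auto
  show "zero \<in> \<pi> ` J"
    using assms hom_zero by (force simp: saturated_right_ideal_def right_ideal_def)
  show "add x y \<in> \<pi> ` J" if "x \<in> \<pi> ` J" "y \<in> \<pi> ` J" for x y
    using assms that
    by (auto simp: saturated_right_ideal_def right_ideal_def hom_add[symmetric])
  show "act x s \<in> \<pi> ` J" if "x \<in> \<pi> ` J" for x s
    using assms that
    by (auto simp: saturated_right_ideal_def right_ideal_def hom_act[symmetric])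
qed

lemma vimage_image_saturated:
  assumes "saturated_right_ideal ker J"
  shows "\<pi> -` (\<pi> ` J) = J"
  using assms by (auto simp: saturated_right_ideal_def)

lemma image_vimage_carrier: "N \<subseteq> M \<Longrightarrow> \<pi> ` (\<pi> -` N) = N"
  using range_eq by blast

lemma vimage_carrier: "\<pi> -` M = UNIV"
  by auto

lemma zero_subsemimodule: "subsemimodule M add zero act {zero}"
proof -
  have "add zero zero = zero"
    using hom_add[of 0 0] hom_zero by simp
  then show ?thesis
    using zero_closed act_zero_left by (simp add: subsemimodule_def)
qed

text \<open>
  The class of \<open>0\<close> is the smallest saturated right ideal and corresponds to the zero
  subsemimodule, so its maximality says that \<open>M\<close> has no proper nonzero subsemimodule. The
  condition \<open>MS \<noteq> 0\<close> corresponds to that class being proper, because \<open>\<pi> s = \<pi> e \<cdot> s\<close> for all \<open>s\<close>.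
\<close>

lemma minimal_iff_ideal:
  "minimal_semimodule M add zero act \<longleftrightarrow> maximal_saturated_right_ideal ker (ker `` {0})"
proof
  assume min: "minimal_semimodule M add zero act"
  show "maximal_saturated_right_ideal ker (ker `` {0})"
    unfolding maximal_saturated_right_ideal_def ker_zero_class
  proof (intro conjI allI impI)
    show "saturated_right_ideal ker (\<pi> -` {zero})"
      by (rule saturated_vimage[OF zero_subsemimodule])
    obtain m s where "m \<in> M" "act m s \<noteq> zero"
      using min unfolding minimal_semimodule_def by blast
    moreover obtain x where "m = \<pi> x"
      using \<open>m \<in> M\<close> range_eq by blast
    ultimately have "x * s \<notin> \<pi> -` {zero}"
      by (simp add: hom_act)
    then show "\<pi> -` {zero} \<noteq> UNIV" by blast
  next
    fix J assume J: "saturated_right_ideal ker J \<and> J \<noteq> UNIV \<and> \<pi> -` {zero} \<subseteq> J"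
    then have "\<pi> ` J = {zero} \<or> \<pi> ` J = M"
      using min subsemimodule_image unfolding minimal_semimodule_def by blast
    then show "J = \<pi> -` {zero}"
      using J vimage_image_saturated[of J] vimage_carrier by auto
  qed
next
  assume max: "maximal_saturated_right_ideal ker (ker `` {0})"
  obtain s where s: "\<pi> s \<noteq> zero"
    using max unfolding maximal_saturated_right_ideal_def ker_zero_class by blast
  show "minimal_semimodule M add zero act"
    unfolding minimal_semimodule_def
  proof (intro conjI allI impI)
    show "right_semimodule M add zero act"
      by unfold_locales
    show "\<exists>m\<in>M. \<exists>s. act m s \<noteq> zero"
      using s image_mem[of e] unit[of s] by (metis hom_act)
  next
    fix N assume N: "subsemimodule M add zero act N"
    then have "\<pi> -` {zero} \<subseteq> \<pi> -` N"
      by (auto simp: subsemimodule_def)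
    then consider "\<pi> -` N = UNIV" | "\<pi> -` N = \<pi> -` {zero}"
      using max saturated_vimage[OF N]
      unfolding maximal_saturated_right_ideal_def ker_zero_class by blast
    then have "\<pi> ` (\<pi> -` N) = M \<or> \<pi> ` (\<pi> -` N) = {zero}"
      using image_vimage_carrier[of "{zero}"] zero_closed range_eq by cases simp_all
    moreover have "N \<subseteq> M"
      using N by (simp add: subsemimodule_def)
    ultimately show "N = {zero} \<or> N = M"
      using image_vimage_carrier[of N] by metis
  qed
qed

theorem minimal_iff_kernel: "minimal_semimodule M add zero act \<longleftrightarrow> ker \<in> RC_m"
  by (simp add: minimal_iff_ideal RC_m_def regular_ker)

subsection \<open>Congruences on the semimodule and right congruences\<close>

lemma right_congruence_pullback:
  assumes "semimodule_congruence M add act \<rho>"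
  shows "right_congruence (inv_image \<rho> \<pi>)"
proof -
  have eq: "equiv M \<rho>"
    using assms by (simp add: semimodule_congruence_def)
  have "equiv UNIV (inv_image \<rho> \<pi>)"
    using eq refl_onD[OF _ image_mem]
    by (auto simp: equiv_def intro!: refl_onI sym_inv_image trans_inv_image)
  then show ?thesis
    using assms unfolding right_congruence_def semimodule_congruence_def
    by (fastforce simp: hom_add hom_act)
qed

lemma ker_subset_pullback:
  assumes "semimodule_congruence M add act \<rho>"
  shows "ker \<subseteq> inv_image \<rho> \<pi>"
  using assms refl_onD[OF _ image_mem]
  by (auto simp: semimodule_congruence_def equiv_def)

lemma pullback_image:
  assumes "right_congruence \<nu>" "ker \<subseteq> \<nu>"
  shows "(\<pi> x, \<pi> y) \<in> map_prod \<pi> \<pi> ` \<nu> \<longleftrightarrow> (x, y) \<in> \<nu>"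
proof
  assume "(\<pi> x, \<pi> y) \<in> map_prod \<pi> \<pi> ` \<nu>"
  then obtain x' y' where *: "(x', y') \<in> \<nu>" "\<pi> x = \<pi> x'" "\<pi> y' = \<pi> y"
    by auto
  have "trans \<nu>"
    using assms(1) by (auto simp: right_congruence_def equiv_def)
  moreover have "(x, x') \<in> \<nu>" "(y', y) \<in> \<nu>"
    using * assms(2) by (auto simp: subset_iff)
  ultimately show "(x, y) \<in> \<nu>"
    using *(1) by (meson transD)
qed force

text \<open>
  The image of a congruence under a surjection need not be transitive; it is here because
  \<open>\<nu>\<close> contains the kernel, so that membership in the image can be tested on arbitrary preimages.
\<close>

lemma semimodule_congruence_image:
  assumes "right_congruence \<nu>" "ker \<subseteq> \<nu>"
  shows "semimodule_congruence M add act (map_prod \<pi> \<pi> ` \<nu>)" (is "semimodule_congruence _ _ _ ?\<rho>")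
proof -
  note mem = pullback_image[OF assms]
  have \<nu>: "refl \<nu>" "sym \<nu>" "trans \<nu>"
    using assms(1) by (auto simp: right_congruence_def equiv_def)
  have comp: "(a + c, b + c) \<in> \<nu>" "(a * c, b * c) \<in> \<nu>" if "(a, b) \<in> \<nu>" for a b c
    using assms(1) that by (auto simp: right_congruence_def)
  have "equiv M ?\<rho>"
  proof (rule equivI)
    show "?\<rho> \<subseteq> M \<times> M" by auto
    show "refl_on M ?\<rho>"
    proof (rule refl_onI)
      fix u assume "u \<in> M"
      then show "(u, u) \<in> ?\<rho>"
        using range_eq mem \<nu>(1) by (auto dest: refl_onD)
    qed
    show "sym ?\<rho>"
      using \<nu>(2) by (force intro!: symI dest: symD)
    show "trans ?\<rho>"
    proof (rule transI)
      fix u v w assume uv: "(u, v) \<in> ?\<rho>" and vw: "(v, w) \<in> ?\<rho>"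
      obtain x y z where "u = \<pi> x" "v = \<pi> y" "w = \<pi> z"
        using uv vw by auto
      then show "(u, w) \<in> ?\<rho>"
        using uv vw mem \<nu>(3) by (auto dest: transD)
    qed
  qed
  moreover have "(add u w, add v w) \<in> ?\<rho>" if uv: "(u, v) \<in> ?\<rho>" and w: "w \<in> M" for u v w
  proof -
    obtain x y z where "u = \<pi> x" "v = \<pi> y" "w = \<pi> z" "(x, y) \<in> \<nu>"
      using uv w range_eq by auto
    then show ?thesis
      using comp(1) mem by (simp add: hom_add[symmetric])
  qed
  moreover have "(act u s, act v s) \<in> ?\<rho>" if uv: "(u, v) \<in> ?\<rho>" for u v s
  proof -
    obtain x y where "u = \<pi> x" "v = \<pi> y" "(x, y) \<in> \<nu>"
      using uv by auto
    then show ?thesis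
      using comp(2) mem by (simp add: hom_act[symmetric])
  qed
  ultimately show ?thesis
    unfolding semimodule_congruence_def by blast
qed

lemma trivial_congruences_iff_maximal:
  assumes "ker \<noteq> UNIV"
  shows "(\<forall>\<rho>. semimodule_congruence M add act \<rho> \<longrightarrow> \<rho> = Id_on M \<or> \<rho> = M \<times> M) \<longleftrightarrow>
    maximal_regular_right_congruence ker"
proof
  assume triv: "\<forall>\<rho>. semimodule_congruence M add act \<rho> \<longrightarrow> \<rho> = Id_on M \<or> \<rho> = M \<times> M"
  show "maximal_regular_right_congruence ker"
    unfolding maximal_regular_right_congruence_def
  proof (intro conjI allI impI)
    fix \<nu> assume "regular_right_congruence \<nu> \<and> \<nu> \<noteq> UNIV \<and> ker \<subseteq> \<nu>"
    then have \<nu>: "right_congruence \<nu>" "ker \<subseteq> \<nu>" "\<nu> \<noteq> UNIV"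
      by (simp_all add: regular_right_congruence_def)
    note mem = pullback_image[OF \<nu>(1,2)]
    consider "map_prod \<pi> \<pi> ` \<nu> = Id_on M" | "map_prod \<pi> \<pi> ` \<nu> = M \<times> M"
      using triv semimodule_congruence_image[OF \<nu>(1,2)] by blast
    then show "\<nu> = ker"
    proof cases
      case 1
      then have "(x, y) \<in> \<nu> \<longleftrightarrow> (x, y) \<in> ker" for x y
        using mem[of x y] by auto
      then show ?thesis by auto
    next
      case 2
      then have "(x, y) \<in> \<nu>" for x y
        using mem[of x y] by auto
      then show ?thesis
        using \<nu>(3) by auto
    qed
  qed (fact regular_ker, fact assms)
next
  assume max: "maximal_regular_right_congruence ker"
  show "\<forall>\<rho>. semimodule_congruence M add act \<rho> \<longrightarrow> \<rho> = Id_on M \<or> \<rho> = M \<times> M"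
  proof (intro allI impI)
    fix \<rho> assume \<rho>: "semimodule_congruence M add act \<rho>"
    note above = right_congruence_pullback[OF \<rho>] ker_subset_pullback[OF \<rho>]
    have sub: "\<rho> \<subseteq> M \<times> M"
      using \<rho> by (auto simp: semimodule_congruence_def equiv_def)
    have image: "\<rho> = map_prod \<pi> \<pi> ` inv_image \<rho> \<pi>"
    proof
      show "\<rho> \<subseteq> map_prod \<pi> \<pi> ` inv_image \<rho> \<pi>"
      proof
        fix p assume p: "p \<in> \<rho>"
        then obtain x y where "p = (\<pi> x, \<pi> y)"
          using sub range_eq by blast
        then show "p \<in> map_prod \<pi> \<pi> ` inv_image \<rho> \<pi>"
          using p by force
      qed
    qed auto
    have "inv_image \<rho> \<pi> = UNIV \<or> inv_image \<rho> \<pi> = ker"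
      using max regular_above_ker[OF above] above(2)
      unfolding maximal_regular_right_congruence_def by blast
    moreover have "map_prod \<pi> \<pi> ` ker = Id_on M"
      unfolding range_eq[symmetric] by (force simp: Id_on_def)
    moreover have "map_prod \<pi> \<pi> ` UNIV = M \<times> M"
      unfolding range_eq[symmetric] by force
    ultimately show "\<rho> = Id_on M \<or> \<rho> = M \<times> M"
      using image by metis
  qed
qed

theorem simple_iff_kernel: "simple_semimodule M add zero act \<longleftrightarrow> ker \<in> RC_s"
proof -
  have "ker \<noteq> UNIV" if "maximal_saturated_right_ideal ker (ker `` {0})"
    using that by (auto simp: maximal_saturated_right_ideal_def)
  then show ?thesis
    unfolding simple_semimodule_def RC_s_def
    using minimal_iff_ideal trivial_congruences_iff_maximal by auto
qed

lemma ann_subset_ker: "ann M act \<subseteq> ker"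
proof (rule subrelI)
  fix s t assume "(s, t) \<in> ann M act"
  then have "act (\<pi> e) s = act (\<pi> e) t"
    by (simp add: ann_def)
  then show "(s, t) \<in> ker"
    using unit by (simp add: hom_act[symmetric])
qed

end

section \<open>Every regular right congruence is the kernel of a presentation\<close>

text \<open>
  The quotient \<open>S/\<mu>\<close> has to live inside the type \<open>'u\<close>. Choosing a representative in each class
  and sending it through the injection \<open>\<iota>\<close> gives a map \<open>\<pi>\<close> with kernel \<open>\<mu>\<close>, and the quotient
  operations are transported to the range of \<open>\<pi>\<close> along a section \<open>\<sigma>\<close> of \<open>\<pi>\<close>.
\<close>

lemma regular_right_congruence_presentation:
  fixes \<iota> :: "'a::semiring_0 \<Rightarrow> 'u" and \<mu> :: "('a \<times> 'a) set"
  assumes "inj \<iota>" "regular_right_congruence \<mu>"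
  obtains M add zero act and \<pi> :: "'a \<Rightarrow> 'u" and e
  where "regular_presentation M add zero act \<pi> e" "regular_presentation.ker \<pi> = \<mu>"
proof -
  have equiv: "equiv UNIV \<mu>"
    using assms(2) by (simp add: regular_right_congruence_def right_congruence_def)
  have cong: "(a + c, b + c) \<in> \<mu>" "(a * c, b * c) \<in> \<mu>" if "(a, b) \<in> \<mu>" for a b c
    using assms(2) that by (auto simp: regular_right_congruence_def right_congruence_def)
  obtain e where e: "(e * s, s) \<in> \<mu>" for s
    using assms(2) by (auto simp: regular_right_congruence_def)
  define \<pi> where "\<pi> x = \<iota> (SOME y. y \<in> \<mu> `` {x})" for x
  have \<pi>_eq: "\<pi> x = \<pi> y \<longleftrightarrow> (x, y) \<in> \<mu>" for x y
  proof
    have some: "(z, SOME w. w \<in> \<mu> `` {z}) \<in> \<mu>" for z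
      using someI[of "\<lambda>w. w \<in> \<mu> `` {z}" z] equiv by (simp add: equiv_def refl_on_def)
    assume "\<pi> x = \<pi> y"
    then have "(SOME w. w \<in> \<mu> `` {x}) = (SOME w. w \<in> \<mu> `` {y})"
      using assms(1) by (simp add: \<pi>_def inj_eq)
    then have "(x, SOME w. w \<in> \<mu> `` {y}) \<in> \<mu>"
      using some[of x] by simp
    then show "(x, y) \<in> \<mu>"
      using some[of y] equiv by (meson equivE symD transD)
  next
    assume "(x, y) \<in> \<mu>"
    then have "\<mu> `` {x} = \<mu> `` {y}"
      using equiv by (rule equiv_class_eq[rotated])
    then show "\<pi> x = \<pi> y" by (simp add: \<pi>_def)
  qed
  define \<sigma> where "\<sigma> = inv_into UNIV \<pi>"
  define add where "add u v = \<pi> (\<sigma> u + \<sigma> v)" for u v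
  define act where "act u s = \<pi> (\<sigma> u * s)" for u s
  have \<sigma>: "(\<sigma> (\<pi> x), x) \<in> \<mu>" for x
    unfolding \<sigma>_def using \<pi>_eq by (metis f_inv_into_f rangeI)
  have act: "act (\<pi> x) s = \<pi> (x * s)" for x s
    unfolding act_def \<pi>_eq using \<sigma> cong(2) by blast
  have add: "add (\<pi> x) (\<pi> y) = \<pi> (x + y)" for x y
  proof -
    have "(\<sigma> (\<pi> x) + \<sigma> (\<pi> y), x + \<sigma> (\<pi> y)) \<in> \<mu>"
      using \<sigma> cong(1) by blast
    moreover have "(\<sigma> (\<pi> y) + x, y + x) \<in> \<mu>"
      using \<sigma> cong(1) by blast
    ultimately show ?thesis
      unfolding add_def by (metis \<pi>_eq add.commute)
  qed
  have monoid: "comm_monoid \<lparr>carrier = range \<pi>, monoid.mult = add, one = \<pi> 0\<rparr>"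
    by (rule comm_monoidI) (auto simp: add ac_simps)
  have module: "right_semimodule (range \<pi>) add (\<pi> 0) act"
    by (unfold_locales; (rule monoid)?) (auto simp: add act algebra_simps)
  interpret regular_presentation "range \<pi>" add "\<pi> 0" act \<pi> e
  proof -
    interpret right_semimodule "range \<pi>" add "\<pi> 0" act by (fact module)
    show "regular_presentation (range \<pi>) add (\<pi> 0) act \<pi> e"
      by unfold_locales (auto simp: add act \<pi>_eq e)
  qed
  have "ker = \<mu>"
    using \<pi>_eq by (auto simp: ker_def)
  then show thesis
    using that regular_presentation_axioms by blast
qed

section \<open>Annihilators of minimal semimodules\<close>

text \<open>
  The orbit \<open>mS\<close> is a subsemimodule, so by minimality it is all of \<open>M\<close> as soon as it is nonzero.
\<close>

lemma minimal_semimodule_presentation: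
  fixes act :: "'u \<Rightarrow> 'a::semiring_0 \<Rightarrow> 'u"
  assumes min: "minimal_semimodule M add zero act" and m: "m \<in> M" and "act m s \<noteq> zero"
  obtains e where "regular_presentation M add zero act (act m) e"
proof -
  interpret right_semimodule M add zero act
    using min by (simp add: minimal_semimodule_def)
  have "subsemimodule M add zero act (range (act m))"
    unfolding subsemimodule_def
  proof (intro conjI ballI allI)
    show "range (act m) \<subseteq> M"
      using m act_closed by blast
    show "zero \<in> range (act m)"
      using act_zero_right[OF m] by (metis rangeI)
    show "add x y \<in> range (act m)" if "x \<in> range (act m)" "y \<in> range (act m)" for x y
      using that act_add_right[OF m, symmetric] by auto
    show "act x t \<in> range (act m)" if "x \<in> range (act m)" for x t
      using that act_mult[OF m, symmetric] by auto
  qed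
  then have range: "range (act m) = M"
    using min \<open>act m s \<noteq> zero\<close> unfolding minimal_semimodule_def by blast
  then obtain e where e: "act m e = m"
    using m by (metis imageE)
  have "regular_presentation M add zero act (act m) e"
  proof
    show "range (act m) = M" by (fact range)
    show "act m (x + y) = add (act m x) (act m y)" for x y
      by (rule act_add_right[OF m])
    show "act m (x * t) = act (act m x) t" for x t
      by (rule act_mult[OF m])
    show "act m (e * t) = act m t" for t
      by (simp add: act_mult[OF m] e)
  qed
  then show thesis
    by (rule that)
qed

text \<open>
  An element \<open>m\<close> with \<open>mS = 0\<close> is harmless, because then \<open>ms = 0 = mt\<close> for all \<open>s\<close> and \<open>t\<close>.
\<close>

lemma in_ann_minimalI:
  fixes act :: "'u \<Rightarrow> 'a::semiring_0 \<Rightarrow> 'u"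
  assumes min: "minimal_semimodule M add zero act"
    and ker: "\<And>\<pi> e. regular_presentation M add zero act \<pi> e \<Longrightarrow>
      (s, t) \<in> regular_presentation.ker \<pi>"
  shows "(s, t) \<in> ann M act"
proof -
  have "act m s = act m t" if m: "m \<in> M" for m
  proof (cases "\<forall>r. act m r = zero")
    case False
    then obtain e where pres: "regular_presentation M add zero act (act m) e"
      using minimal_semimodule_presentation[OF min m] by blast
    then show ?thesis
      using ker[OF pres] regular_presentation.mem_ker[OF pres] by simp
  qed simp
  then show ?thesis
    by (simp add: ann_def)
qed

section \<open>The radicals as intersections of right congruences\<close>

theorem theorem3p8:
  fixes \<iota> :: "'a::semiring_0 \<Rightarrow> 'u"
  assumes "inj \<iota>"
  shows "(rad_m TYPE('u) :: ('a \<times> 'a) set) = \<Inter> RC_m \<and>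
         (rad_s TYPE('u) :: ('a \<times> 'a) set) = \<Inter> RC_s"
proof (intro conjI equalityI)
  show "(rad_m TYPE('u) :: ('a \<times> 'a) set) \<subseteq> \<Inter> RC_m"
  proof (rule Inter_greatest)
    fix \<mu> :: "('a \<times> 'a) set" assume \<mu>: "\<mu> \<in> RC_m"
    then have "regular_right_congruence \<mu>"
      by (simp add: RC_m_def)
    then obtain M add zero act and \<pi> :: "'a \<Rightarrow> 'u" and e
      where pres: "regular_presentation M add zero act \<pi> e"
        and ker: "regular_presentation.ker \<pi> = \<mu>"
      using regular_right_congruence_presentation[OF assms] by blast
    have "minimal_semimodule M add zero act"
      using regular_presentation.minimal_iff_kernel[OF pres] ker \<mu> by simp
    then have "rad_m TYPE('u) \<subseteq> ann M act"
      unfolding rad_m_def by blast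
    then show "rad_m TYPE('u) \<subseteq> \<mu>"
      using regular_presentation.ann_subset_ker[OF pres] ker by blast
  qed
  show "(rad_s TYPE('u) :: ('a \<times> 'a) set) \<subseteq> \<Inter> RC_s"
  proof (rule Inter_greatest)
    fix \<mu> :: "('a \<times> 'a) set" assume \<mu>: "\<mu> \<in> RC_s"
    then have "regular_right_congruence \<mu>"
      by (simp add: RC_s_def maximal_regular_right_congruence_def)
    then obtain M add zero act and \<pi> :: "'a \<Rightarrow> 'u" and e
      where pres: "regular_presentation M add zero act \<pi> e"
        and ker: "regular_presentation.ker \<pi> = \<mu>"
      using regular_right_congruence_presentation[OF assms] by blast
    have "simple_semimodule M add zero act"
      using regular_presentation.simple_iff_kernel[OF pres] ker \<mu> by simp
    then have "rad_s TYPE('u) \<subseteq> ann M act"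
      unfolding rad_s_def by blast
    then show "rad_s TYPE('u) \<subseteq> \<mu>"
      using regular_presentation.ann_subset_ker[OF pres] ker by blast
  qed
  have "\<Inter> RC_m \<subseteq> ann M act" if min: "minimal_semimodule M add zero act"
    for M :: "'u set" and add zero and act :: "'u \<Rightarrow> 'a \<Rightarrow> 'u"
  proof (rule subrelI)
    fix s t assume st: "(s, t) \<in> (\<Inter> RC_m :: ('a \<times> 'a) set)"
    show "(s, t) \<in> ann M act"
    proof (rule in_ann_minimalI[OF min])
      fix \<pi> e assume pres: "regular_presentation M add zero act \<pi> e"
      then show "(s, t) \<in> regular_presentation.ker \<pi>"
        using regular_presentation.minimal_iff_kernel[OF pres] min st by simp
    qed
  qed
  then show "\<Inter> RC_m \<subseteq> (rad_m TYPE('u) :: ('a \<times> 'a) set)"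
    unfolding rad_m_def by blast
  have "\<Inter> RC_s \<subseteq> ann M act" if simple: "simple_semimodule M add zero act"
    for M :: "'u set" and add zero and act :: "'u \<Rightarrow> 'a \<Rightarrow> 'u"
  proof (rule subrelI)
    fix s t assume st: "(s, t) \<in> (\<Inter> RC_s :: ('a \<times> 'a) set)"
    have min: "minimal_semimodule M add zero act"
      using simple by (simp add: simple_semimodule_def)
    show "(s, t) \<in> ann M act"
    proof (rule in_ann_minimalI[OF min])
      fix \<pi> e assume pres: "regular_presentation M add zero act \<pi> e"
      then show "(s, t) \<in> regular_presentation.ker \<pi>"
        using regular_presentation.simple_iff_kernel[OF pres] simple st by simp
    qed
  qed
  then show "\<Inter> RC_s \<subseteq> (rad_s TYPE('u) :: ('a \<times> 'a) set)"
    unfolding rad_s_def by blast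
qed

end
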